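(* Let $0<\alpha<1$, $n\ge1$, and let $(z^k)_{k=0}^{n-1}$ be a sequence with values in a normed vector space. Assume that the set of values $\{z^0,\dots,z^{n-1}\}$ has diameter at most $D$. Define $$\bar z^{\,n-1}=\sum_{r=0}^{n-2}\omega_r^{(\alpha)}z^{n-1-r}+\omega_{n-1}^{(\alpha)}z^0 .$$ Then $$\|\bar z^{\,n-1}-z^{n-1}\|\le\sum_{r=1}^{n-1}\omega_r^{(\alpha)}\|z^{n-1-r}-z^{n-1}\| .$$ If, in addition, $z^{n-1}=z^{n-2}=\cdots=z^{n-q}$ for some $1\le q\le n-1$, then $$\|\bar z^{\,n-1}-z^{n-1}\|\le D\,b_q=D\bigl((q+1)^{1-\alpha}-q^{1-\alpha}\bigr).$$ For scalar phase indicators in $L^\infty$, or coordinate-vector phase indicators in the pointwise $\ell^\infty$-norm, one may take $D=1$.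
   Context: L1 weights: $b_k:=(k+1)^{1-\alpha}-k^{1-\alpha}$ for $k\ge0$. For a given $n\ge1$, the history weights are $$\omega_r^{(\alpha)}:=b_r-b_{r+1}\quad(0\le r\le n-2),\qquad \omega_{n-1}^{(\alpha)}:=b_{n-1}.$$ Empty sums are zero. Let $\Omega=[0,\Lambda)^d\cong\mathbb{T}^d$ be the flat torus. Scalar phase indicators are elements of $L^\infty(\Omega;\{0,1\})$ with the $L^\infty$ norm. Coordinate-vector phase indicators are measurable functions on $\Omega$ with values in the set $\{e_1,\dots,e_P\}$ of standard basis vectors of $\mathbb{R}^P$, with norm $\operatorname{ess\,sup}_{x}\|z(x)\|_{\ell^\infty}$. *)

theory Defs
  imports "HOL-Probability.Essential_Supremum"
begin

definition L1_weight :: "real \<Rightarrow> nat \<Rightarrow> real" where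
  "L1_weight \<alpha> k = (real k + 1) powr (1 - \<alpha>) - real k powr (1 - \<alpha>)"

(* only meaningful for r < n; the last index r = n - 1 carries the weight b_(n-1) *)
definition history_weight :: "real \<Rightarrow> nat \<Rightarrow> nat \<Rightarrow> real" where
  "history_weight \<alpha> n r =
     (if Suc r = n then L1_weight \<alpha> r else L1_weight \<alpha> r - L1_weight \<alpha> (Suc r))"

definition history_mean :: "real \<Rightarrow> nat \<Rightarrow> (nat \<Rightarrow> 'a::real_vector) \<Rightarrow> 'a" where
  "history_mean \<alpha> n z =
     (\<Sum>r<n - 1. history_weight \<alpha> n r *\<^sub>R z (n - 1 - r)) + history_weight \<alpha> n (n - 1) *\<^sub>R z 0"

(* The flat torus enters only through its measure space, that of the fundamental cell
   [0,L)^d with Lebesgue measure. *)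
definition torus_cell :: "real \<Rightarrow> (real ^ 'd) set" where
  "torus_cell L = {x. \<forall>i. 0 \<le> x $ i \<and> x $ i < L}"

abbreviation torus_measure :: "real \<Rightarrow> (real ^ 'd) measure" where
  "torus_measure L \<equiv> lebesgue_on (torus_cell L)"

(* Elements of L^infinity are handled through representatives: equality and membership in a
   set of values are understood almost everywhere. N is the norm on the values. The result is
   extended real, and equals infinity for functions that are not essentially bounded. *)
definition Linf_norm :: "('b \<Rightarrow> real) \<Rightarrow> 'x measure \<Rightarrow> ('x \<Rightarrow> 'b) \<Rightarrow> ereal" where
  "Linf_norm N M f = esssup M (\<lambda>x. ereal (N (f x)))"

definition scalar_phase_indicator :: "'x measure \<Rightarrow> ('x \<Rightarrow> real) \<Rightarrow> bool" where
  "scalar_phase_indicator M f \<longleftrightarrow> f \<in> borel_measurable M \<and> (AE x in M. f x \<in> {0, 1})"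

definition vector_phase_indicator :: "'x measure \<Rightarrow> ('x \<Rightarrow> real ^ 'p) \<Rightarrow> bool" where
  "vector_phase_indicator M f \<longleftrightarrow>
     f \<in> borel_measurable M \<and> (AE x in M. f x \<in> range (\<lambda>i. axis i 1))"

end

theory Submission
  imports Defs
begin

text \<open>The weights \<open>b\<^sub>k\<close> decrease, because \<open>x powr (1 - \<alpha>)\<close> is concave, so the history weights are
  non-negative, and they telescope: \<open>\<omega>\<^sub>q + \<dots> + \<omega>\<^sub>n\<^sub>-\<^sub>1 = b\<^sub>q\<close>. As \<open>b\<^sub>0 = 1\<close>, the history mean is a
  convex combination, and both estimates follow from the triangle inequality. For phase indicators
  they are applied pointwise almost everywhere.\<close>

section \<open>Monotonicity and telescoping of the weights\<close>

lemma L1_weight_Suc_le: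
  assumes "0 < \<alpha>" "\<alpha> < 1"
  shows "L1_weight \<alpha> (Suc k) \<le> L1_weight \<alpha> k"
proof -
  let ?g = "\<lambda>x::real. (x + 1) powr (1 - \<alpha>) - x powr (1 - \<alpha>)"
  have "?g (real k + 1) \<le> ?g (real k)"
  \<comment> \<open>Only interior derivatives are asked for: when \<open>k = 0\<close> the left
    endpoint is 0, where \<open>x powr (1 - \<alpha>)\<close> has infinite slope.\<close>
  proof (rule DERIV_nonpos_imp_decreasing_open[where f = ?g])
    show "\<exists>y. (?g has_real_derivative y) (at x) \<and> y \<le> 0"
      if x: "real k < x" "x < real k + 1" for x
    proof (intro exI conjI)
      have "0 < x" using x by linarith
      then show "(?g has_real_derivative
          (1 - \<alpha>) * (x + 1) powr (- \<alpha>) - (1 - \<alpha>) * x powr (- \<alpha>)) (at x)"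
        by (auto intro!: derivative_eq_intros)
      have "(x + 1) powr (- \<alpha>) \<le> x powr (- \<alpha>)"
        using \<open>0 < x\<close> assms by (intro powr_mono2') auto
      then show "(1 - \<alpha>) * (x + 1) powr (- \<alpha>) - (1 - \<alpha>) * x powr (- \<alpha>) \<le> 0"
        using assms by (simp add: mult_left_mono)
    qed
    \<comment> \<open>Continuity up to the point 0 rests on the exponent \<open>1 - \<alpha>\<close>
      being positive.\<close>
    show "continuous_on {real k..real k + 1} ?g"
      using assms by (intro continuous_intros continuous_on_powr') auto
  qed simp
  then show ?thesis by (simp add: L1_weight_def add.commute)
qed

lemma L1_weight_nonneg:
  assumes "\<alpha> < 1"
  shows "0 \<le> L1_weight \<alpha> k"
  using assms by (simp add: L1_weight_def powr_mono2)

lemma history_weight_nonneg: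
  assumes "0 < \<alpha>" "\<alpha> < 1"
  shows "0 \<le> history_weight \<alpha> n r"
  using L1_weight_Suc_le[OF assms] L1_weight_nonneg[OF assms(2)] by (simp add: history_weight_def)

text \<open>The differences with \<open>r < n - 1\<close> telescope to b_q - b_(n-1), and the
  exceptional last weight b_(n-1) cancels the remainder. The case \<open>q = 0\<close> gives total
  weight 1, the case \<open>q \<ge> 1\<close> the tail in the second estimate.\<close>

lemma sum_history_weight:
  assumes "q < n"
  shows "(\<Sum>r = q..n - 1. history_weight \<alpha> n r) = L1_weight \<alpha> q"
proof -
  obtain m where n: "n = Suc m" "q \<le> m"
    using assms by (cases n) auto
  have "(\<Sum>r = q..m. history_weight \<alpha> n r)
      = (\<Sum>r = q..<m. history_weight \<alpha> n r) + history_weight \<alpha> n m"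
    using n by (simp add: sum.last_plus)
  \<comment> \<open>The sign is reversed to match the telescoping rule, whose summands are later
    term minus earlier term.\<close>
  also have "(\<Sum>r = q..<m. history_weight \<alpha> n r)
      = - (\<Sum>r = q..<m. L1_weight \<alpha> (Suc r) - L1_weight \<alpha> r)"
    unfolding sum_negf[symmetric] by (rule sum.cong) (auto simp: history_weight_def n)
  also have "\<dots> = L1_weight \<alpha> q - L1_weight \<alpha> m"
    using n by (simp only: sum_Suc_diff' minus_diff_eq)
  finally show ?thesis by (simp add: history_weight_def n)
qed

text \<open>Since the weights sum to 1, \<open>z (n - 1)\<close> can be distributed over them; the
  summand \<open>r = 0\<close> then vanishes.\<close>

lemma history_mean_diff_last:
  assumes "1 \<le> n"
  shows "history_mean \<alpha> n z - z (n - 1)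
    = (\<Sum>r = 1..n - 1. history_weight \<alpha> n r *\<^sub>R (z (n - 1 - r) - z (n - 1)))"
proof -
  obtain m where n: "n = Suc m"
    using assms by (cases n) auto
  \<comment> \<open>The separate \<open>z 0\<close> term is the summand
    \<open>r = m\<close>.\<close>
  have "history_mean \<alpha> n z = (\<Sum>r = 0..m. history_weight \<alpha> n r *\<^sub>R z (m - r))"
    by (simp add: history_mean_def n atLeast0AtMost lessThan_Suc_atMost[symmetric])
  \<comment> \<open>The total weight is b_0 = 1, where
    \<open>0 powr (1 - \<alpha>) = 0\<close>.\<close>
  moreover have "z m = (\<Sum>r = 0..m. history_weight \<alpha> n r *\<^sub>R z m)"
    using sum_history_weight[of 0 n \<alpha>] by (simp add: n L1_weight_def flip: scaleR_left.sum)
  ultimately have "history_mean \<alpha> n z - z m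
      = (\<Sum>r = 0..m. history_weight \<alpha> n r *\<^sub>R (z (m - r) - z m))"
    by (simp add: scaleR_diff_right sum_subtractf)
  then show ?thesis
    by (simp add: n sum.atLeast_Suc_atMost)
qed

section \<open>Both estimates for an arbitrary seminorm\<close>

locale seminorm =
  fixes N :: "'a::real_vector \<Rightarrow> real"
  assumes add_le: "N (x + y) \<le> N x + N y"
    and scaleR: "N (c *\<^sub>R x) = \<bar>c\<bar> * N x"
begin

lemma zero: "N 0 = 0"
  using scaleR[of 0 0] by simp

lemma sum_le: "N (sum f A) \<le> (\<Sum>i\<in>A. N (f i))"
  by (induction A rule: infinite_finite_induct) (auto simp: zero intro: order_trans[OF add_le])

lemma history_mean_le:
  assumes "0 < \<alpha>" "\<alpha> < 1" "1 \<le> n"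
  shows "N (history_mean \<alpha> n z - z (n - 1))
    \<le> (\<Sum>r = 1..n - 1. history_weight \<alpha> n r * N (z (n - 1 - r) - z (n - 1)))"
  unfolding history_mean_diff_last[OF assms(3)]
  by (rule order_trans[OF sum_le]) (simp add: scaleR abs_of_nonneg history_weight_nonneg assms)

text \<open>The repeated values kill the summands with \<open>r < q\<close>; each remaining one is
  at most \<open>D\<close> times its weight, and these weights sum to b_q. Bounding only distances
  to \<open>z (n - 1)\<close> lets the estimate be applied at a single point of the domain.\<close>

lemma history_mean_le_L1_weight:
  assumes \<alpha>: "0 < \<alpha>" "\<alpha> < 1"
    and q: "1 \<le> q" "q \<le> n - 1"
    and eq: "\<And>j. j \<in> {1..q} \<Longrightarrow> z (n - j) = z (n - 1)"
    and D: "\<And>k. k < n \<Longrightarrow> N (z k - z (n - 1)) \<le> D"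
  shows "N (history_mean \<alpha> n z - z (n - 1)) \<le> D * L1_weight \<alpha> q"
proof -
  have "N (history_mean \<alpha> n z - z (n - 1))
      \<le> (\<Sum>r = 1..n - 1. history_weight \<alpha> n r * N (z (n - 1 - r) - z (n - 1)))"
    using q by (intro history_mean_le \<alpha>) simp
  also have "\<dots> = (\<Sum>r = q..n - 1. history_weight \<alpha> n r * N (z (n - 1 - r) - z (n - 1)))"
  proof (rule sum.mono_neutral_right)
    show "\<forall>r\<in>{1..n - 1} - {q..n - 1}. history_weight \<alpha> n r * N (z (n - 1 - r) - z (n - 1)) = 0"
    proof
      fix r assume "r \<in> {1..n - 1} - {q..n - 1}"
      \<comment> \<open>Index shift: \<open>n - 1 - r = n - Suc r\<close>, and \<open>r < q\<close>
        puts \<open>Suc r\<close> in \<open>{1..q}\<close>.\<close>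
      then have "z (n - 1 - r) = z (n - 1)"
        using eq[of "Suc r"] by auto
      then show "history_weight \<alpha> n r * N (z (n - 1 - r) - z (n - 1)) = 0"
        by (simp add: zero)
    qed
  qed (use q in auto)
  also have "\<dots> \<le> (\<Sum>r = q..n - 1. history_weight \<alpha> n r * D)"
    using q by (intro sum_mono mult_left_mono D history_weight_nonneg \<alpha>) auto
  also have "\<dots> = D * L1_weight \<alpha> q"
    using q sum_history_weight[of q n \<alpha>] by (simp add: mult.commute flip: sum_distrib_left)
  finally show ?thesis .
qed

end

interpretation norm: seminorm "norm :: 'a::real_normed_vector \<Rightarrow> real"
  by unfold_locales (auto simp: norm_triangle_ineq)

interpretation abs: seminorm "abs :: real \<Rightarrow> real"
  by unfold_locales (auto simp: abs_mult)

text \<open>The type class norm of \<open>real ^ 'p\<close> is Euclidean, so the maximum norm enters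
  as a seminorm of its own.\<close>

interpretation infnorm: seminorm "infnorm :: 'a::euclidean_space \<Rightarrow> real"
  by unfold_locales (auto simp: infnorm_triangle infnorm_mul)

section \<open>From pointwise estimates to essential suprema\<close>

locale measurable_seminorm = seminorm N for N :: "'a::euclidean_space \<Rightarrow> real" +
  assumes measurable [measurable]: "N \<in> borel_measurable borel"
begin

text \<open>Off a finite union of null sets, every difference is at most its essential supremum;
  there the pointwise estimate applies, and the non-negative weights preserve the
  inequality.\<close>

lemma Linf_norm_history_mean_le:
  assumes \<alpha>: "0 < \<alpha>" "\<alpha> < 1" and n: "1 \<le> n"
    and f: "\<And>k. k < n \<Longrightarrow> f k \<in> borel_measurable M"
  shows "Linf_norm N M (\<lambda>x. history_mean \<alpha> n (\<lambda>k. f k x) - f (n - 1) x)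
    \<le> (\<Sum>r = 1..n - 1. ereal (history_weight \<alpha> n r)
          * Linf_norm N M (\<lambda>x. f (n - 1 - r) x - f (n - 1) x))"
  unfolding Linf_norm_def
proof (rule esssup_I)
  \<comment> \<open>An upper bound for \<open>esssup\<close> calls for measurability besides the
    almost everywhere bound.\<close>
  show "(\<lambda>x. ereal (N (history_mean \<alpha> n (\<lambda>k. f k x) - f (n - 1) x))) \<in> borel_measurable M"
    unfolding history_mean_def using n f
    by (intro borel_measurable_ereal measurable_compose[OF _ measurable] borel_measurable_diff
        borel_measurable_add borel_measurable_sum borel_measurable_scaleR borel_measurable_const) auto
  have "AE x in M. \<forall>r\<in>{1..n - 1}. ereal (N (f (n - 1 - r) x - f (n - 1) x))
      \<le> esssup M (\<lambda>x. ereal (N (f (n - 1 - r) x - f (n - 1) x)))"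
    by (intro AE_finite_allI esssup_AE) simp
  then show "AE x in M. ereal (N (history_mean \<alpha> n (\<lambda>k. f k x) - f (n - 1) x))
      \<le> (\<Sum>r = 1..n - 1. ereal (history_weight \<alpha> n r)
            * esssup M (\<lambda>x. ereal (N (f (n - 1 - r) x - f (n - 1) x))))"
  proof eventually_elim
    case (elim x)
    have "ereal (N (history_mean \<alpha> n (\<lambda>k. f k x) - f (n - 1) x))
        \<le> (\<Sum>r = 1..n - 1. ereal (history_weight \<alpha> n r) * ereal (N (f (n - 1 - r) x - f (n - 1) x)))"
      using history_mean_le[OF \<alpha> n, of "\<lambda>k. f k x"] by simp
    also have "\<dots> \<le> (\<Sum>r = 1..n - 1. ereal (history_weight \<alpha> n r)
            * esssup M (\<lambda>x. ereal (N (f (n - 1 - r) x - f (n - 1) x))))"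
      using elim by (intro sum_mono ereal_mult_left_mono) (auto simp: history_weight_nonneg \<alpha>)
    finally show ?case .
  qed
qed

text \<open>Equalities and bounds hold only almost everywhere, but there are finitely many of them,
  so at almost every \<open>x\<close> the sequence \<open>\<lambda>k. f k x\<close> satisfies all of
  them at once.\<close>

lemma Linf_norm_history_mean_le_L1_weight:
  assumes \<alpha>: "0 < \<alpha>" "\<alpha> < 1" and q: "1 \<le> q" "q \<le> n - 1"
    and eq: "\<And>j. j \<in> {1..q} \<Longrightarrow> AE x in M. f (n - j) x = f (n - 1) x"
    and f: "\<And>k. k < n \<Longrightarrow> f k \<in> borel_measurable M"
    and D: "\<And>k. k < n \<Longrightarrow> AE x in M. N (f k x - f (n - 1) x) \<le> D"
  shows "Linf_norm N M (\<lambda>x. history_mean \<alpha> n (\<lambda>k. f k x) - f (n - 1) x)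
    \<le> ereal (D * L1_weight \<alpha> q)"
  unfolding Linf_norm_def
proof (rule esssup_I)
  show "(\<lambda>x. ereal (N (history_mean \<alpha> n (\<lambda>k. f k x) - f (n - 1) x))) \<in> borel_measurable M"
    unfolding history_mean_def using q f
    by (intro borel_measurable_ereal measurable_compose[OF _ measurable] borel_measurable_diff
        borel_measurable_add borel_measurable_sum borel_measurable_scaleR borel_measurable_const) auto
  have "AE x in M. \<forall>j\<in>{1..q}. f (n - j) x = f (n - 1) x"
    by (intro AE_finite_allI eq) auto
  moreover have "AE x in M. \<forall>k\<in>{..<n}. N (f k x - f (n - 1) x) \<le> D"
    by (intro AE_finite_allI D) auto
  ultimately show "AE x in M. ereal (N (history_mean \<alpha> n (\<lambda>k. f k x) - f (n - 1) x))
      \<le> ereal (D * L1_weight \<alpha> q)"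
  proof eventually_elim
    case (elim x)
    have "N (history_mean \<alpha> n (\<lambda>k. f k x) - f (n - 1) x) \<le> D * L1_weight \<alpha> q"
      by (rule history_mean_le_L1_weight[where z = "\<lambda>k. f k x", OF \<alpha> q bspec[OF elim(1)] bspec[OF elim(2)]]) simp_all
    then show ?case by simp
  qed
qed

lemma Linf_norm_diff_le:
  assumes "f \<in> borel_measurable M" "g \<in> borel_measurable M" "AE x in M. N (f x - g x) \<le> D"
  shows "Linf_norm N M (\<lambda>x. f x - g x) \<le> ereal D"
  unfolding Linf_norm_def using assms by (intro esssup_I) auto

end

interpretation abs: measurable_seminorm "abs :: real \<Rightarrow> real"
  by unfold_locales simp

interpretation infnorm: measurable_seminorm "infnorm :: 'a::euclidean_space \<Rightarrow> real"
  by unfold_locales (intro borel_measurable_continuous_onI continuous_intros)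

section \<open>Distances between phase indicators\<close>

lemma scalar_phase_indicator_diff:
  assumes "scalar_phase_indicator M f" "scalar_phase_indicator M g"
  shows "AE x in M. \<bar>f x - g x\<bar> \<le> 1"
proof -
  have "AE x in M. f x \<in> {0, 1}" "AE x in M. g x \<in> {0, 1}"
    using assms by (auto simp: scalar_phase_indicator_def)
  then show ?thesis by eventually_elim auto
qed

text \<open>Every coordinate of the difference is -1, 0 or 1. The Euclidean norm would give
  \<open>sqrt 2\<close> for distinct indices.\<close>

lemma infnorm_axis_diff_le: "infnorm (axis i 1 - axis j 1 :: real ^ 'p) \<le> 1"
  by (auto simp: infnorm_Max Basis_vec_def inner_axis) (simp add: axis_def)

lemma vector_phase_indicator_diff:
  assumes "vector_phase_indicator M f" "vector_phase_indicator M g"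
  shows "AE x in M. infnorm (f x - g x) \<le> 1"
proof -
  have "AE x in M. f x \<in> range (\<lambda>i. axis i 1)" "AE x in M. g x \<in> range (\<lambda>i. axis i 1)"
    using assms by (auto simp: vector_phase_indicator_def)
  then show ?thesis by eventually_elim (auto simp: infnorm_axis_diff_le)
qed

theorem lemma4p2:
  fixes \<alpha> D \<Lambda> :: real and n :: nat
    and z :: "nat \<Rightarrow> 'a::real_normed_vector"
    and u :: "nat \<Rightarrow> real ^ 'd \<Rightarrow> real"
    and v :: "nat \<Rightarrow> real ^ 'd \<Rightarrow> real ^ 'p"
  assumes "0 < \<alpha>" "\<alpha> < 1" "1 \<le> n" "0 < \<Lambda>"
  shows
    "(diameter (z ` {..<n}) \<le> D \<longrightarrow>
       norm (history_mean \<alpha> n z - z (n - 1))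
         \<le> (\<Sum>r = 1..n - 1. history_weight \<alpha> n r * norm (z (n - 1 - r) - z (n - 1))) \<and>
       (\<forall>q. 1 \<le> q \<and> q \<le> n - 1 \<and> (\<forall>j\<in>{1..q}. z (n - j) = z (n - 1)) \<longrightarrow>
         norm (history_mean \<alpha> n z - z (n - 1)) \<le> D * L1_weight \<alpha> q \<and>
         D * L1_weight \<alpha> q = D * ((real q + 1) powr (1 - \<alpha>) - real q powr (1 - \<alpha>)))) \<and>
     ((\<forall>k<n. scalar_phase_indicator (torus_measure \<Lambda>) (u k)) \<longrightarrow>
       (\<forall>i<n. \<forall>k<n. Linf_norm abs (torus_measure \<Lambda>) (\<lambda>x. u i x - u k x) \<le> 1) \<and>
       Linf_norm abs (torus_measure \<Lambda>) (\<lambda>x. history_mean \<alpha> n (\<lambda>k. u k x) - u (n - 1) x)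
         \<le> (\<Sum>r = 1..n - 1. ereal (history_weight \<alpha> n r) *
               Linf_norm abs (torus_measure \<Lambda>) (\<lambda>x. u (n - 1 - r) x - u (n - 1) x)) \<and>
       (\<forall>q. 1 \<le> q \<and> q \<le> n - 1 \<and>
            (\<forall>j\<in>{1..q}. AE x in torus_measure \<Lambda>. u (n - j) x = u (n - 1) x) \<longrightarrow>
         Linf_norm abs (torus_measure \<Lambda>) (\<lambda>x. history_mean \<alpha> n (\<lambda>k. u k x) - u (n - 1) x)
           \<le> ereal (L1_weight \<alpha> q))) \<and>
     ((\<forall>k<n. vector_phase_indicator (torus_measure \<Lambda>) (v k)) \<longrightarrow>
       (\<forall>i<n. \<forall>k<n. Linf_norm infnorm (torus_measure \<Lambda>) (\<lambda>x. v i x - v k x) \<le> 1) \<and>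
       Linf_norm infnorm (torus_measure \<Lambda>) (\<lambda>x. history_mean \<alpha> n (\<lambda>k. v k x) - v (n - 1) x)
         \<le> (\<Sum>r = 1..n - 1. ereal (history_weight \<alpha> n r) *
               Linf_norm infnorm (torus_measure \<Lambda>) (\<lambda>x. v (n - 1 - r) x - v (n - 1) x)) \<and>
       (\<forall>q. 1 \<le> q \<and> q \<le> n - 1 \<and>
            (\<forall>j\<in>{1..q}. AE x in torus_measure \<Lambda>. v (n - j) x = v (n - 1) x) \<longrightarrow>
         Linf_norm infnorm (torus_measure \<Lambda>) (\<lambda>x. history_mean \<alpha> n (\<lambda>k. v k x) - v (n - 1) x)
           \<le> ereal (L1_weight \<alpha> q)))"
proof (intro conjI impI allI)
  assume D: "diameter (z ` {..<n}) \<le> D"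
  show "norm (history_mean \<alpha> n z - z (n - 1))
      \<le> (\<Sum>r = 1..n - 1. history_weight \<alpha> n r * norm (z (n - 1 - r) - z (n - 1)))"
    by (rule norm.history_mean_le) fact+
  fix q
  assume q: "1 \<le> q \<and> q \<le> n - 1 \<and> (\<forall>j\<in>{1..q}. z (n - j) = z (n - 1))"
  \<comment> \<open>The value set is finite, hence bounded, so its \<open>diameter\<close> does
    dominate all pairwise distances.\<close>
  have "norm (z k - z (n - 1)) \<le> D" if "k < n" for k
    using diameter_bounded_bound[of "z ` {..<n}" "z k" "z (n - 1)"] that D
    by (simp add: finite_imp_bounded dist_norm)
  then show "norm (history_mean \<alpha> n z - z (n - 1)) \<le> D * L1_weight \<alpha> q"
    using q assms by (intro norm.history_mean_le_L1_weight) blast+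
  show "D * L1_weight \<alpha> q = D * ((real q + 1) powr (1 - \<alpha>) - real q powr (1 - \<alpha>))"
    by (simp add: L1_weight_def)
next
  assume u: "\<forall>k<n. scalar_phase_indicator (torus_measure \<Lambda>) (u k)"
  then have meas: "u k \<in> borel_measurable (torus_measure \<Lambda>)" if "k < n" for k
    using that by (simp add: scalar_phase_indicator_def)
  have diff: "AE x in torus_measure \<Lambda>. \<bar>u i x - u k x\<bar> \<le> 1" if "i < n" "k < n" for i k
    using u that by (simp add: scalar_phase_indicator_diff)
  show "Linf_norm abs (torus_measure \<Lambda>) (\<lambda>x. u i x - u k x) \<le> 1" if "i < n" "k < n" for i k
    using abs.Linf_norm_diff_le[OF meas meas diff] that by (simp add: one_ereal_def)
  show "Linf_norm abs (torus_measure \<Lambda>) (\<lambda>x. history_mean \<alpha> n (\<lambda>k. u k x) - u (n - 1) x)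
      \<le> (\<Sum>r = 1..n - 1. ereal (history_weight \<alpha> n r) *
            Linf_norm abs (torus_measure \<Lambda>) (\<lambda>x. u (n - 1 - r) x - u (n - 1) x))"
    using assms meas by (intro abs.Linf_norm_history_mean_le) auto
  show "Linf_norm abs (torus_measure \<Lambda>) (\<lambda>x. history_mean \<alpha> n (\<lambda>k. u k x) - u (n - 1) x)
      \<le> ereal (L1_weight \<alpha> q)"
    if q: "1 \<le> q \<and> q \<le> n - 1 \<and>
      (\<forall>j\<in>{1..q}. AE x in torus_measure \<Lambda>. u (n - j) x = u (n - 1) x)" for q
  proof -
    have "n - 1 < n" using assms by simp
    \<comment> \<open>The factor 1 is written out so that the general bound matches with
      \<open>D = 1\<close>.\<close>
    then have "Linf_norm abs (torus_measure \<Lambda>) (\<lambda>x. history_mean \<alpha> n (\<lambda>k. u k x) - u (n - 1) x)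
        \<le> ereal (1 * L1_weight \<alpha> q)"
      using q assms meas diff by (intro abs.Linf_norm_history_mean_le_L1_weight) blast+
    then show ?thesis by simp
  qed
next
  \<comment> \<open>The argument is the scalar one with \<open>infnorm\<close> in place of
    \<open>abs\<close>.\<close>
  assume v: "\<forall>k<n. vector_phase_indicator (torus_measure \<Lambda>) (v k)"
  then have meas: "v k \<in> borel_measurable (torus_measure \<Lambda>)" if "k < n" for k
    using that by (simp add: vector_phase_indicator_def)
  have diff: "AE x in torus_measure \<Lambda>. infnorm (v i x - v k x) \<le> 1" if "i < n" "k < n" for i k
    using v that by (simp add: vector_phase_indicator_diff)
  show "Linf_norm infnorm (torus_measure \<Lambda>) (\<lambda>x. v i x - v k x) \<le> 1" if "i < n" "k < n" for i k
    using infnorm.Linf_norm_diff_le[OF meas meas diff] that by (simp add: one_ereal_def)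
  show "Linf_norm infnorm (torus_measure \<Lambda>) (\<lambda>x. history_mean \<alpha> n (\<lambda>k. v k x) - v (n - 1) x)
      \<le> (\<Sum>r = 1..n - 1. ereal (history_weight \<alpha> n r) *
            Linf_norm infnorm (torus_measure \<Lambda>) (\<lambda>x. v (n - 1 - r) x - v (n - 1) x))"
    using assms meas by (intro infnorm.Linf_norm_history_mean_le) auto
  show "Linf_norm infnorm (torus_measure \<Lambda>) (\<lambda>x. history_mean \<alpha> n (\<lambda>k. v k x) - v (n - 1) x)
      \<le> ereal (L1_weight \<alpha> q)"
    if q: "1 \<le> q \<and> q \<le> n - 1 \<and>
      (\<forall>j\<in>{1..q}. AE x in torus_measure \<Lambda>. v (n - j) x = v (n - 1) x)" for q
  proof -
    have "n - 1 < n" using assms by simp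
    then have "Linf_norm infnorm (torus_measure \<Lambda>) (\<lambda>x. history_mean \<alpha> n (\<lambda>k. v k x) - v (n - 1) x)
        \<le> ereal (1 * L1_weight \<alpha> q)"
      using q assms meas diff by (intro infnorm.Linf_norm_history_mean_le_L1_weight) blast+
    then show ?thesis by simp
  qed
qed

end
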